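(* Let $L$ be a finite-dimensional Lie algebra over $\mathbb{C}$. Then $\operatorname{AID}(L)$ is a Lie ideal of $\operatorname{Der}(L)$.
   Context: $\operatorname{Der}(L)$ is the Lie algebra of derivations of $L$ under the commutator bracket. A derivation $D\in\operatorname{Der}(L)$ is called almost inner if $D(x)\in[L,x]=\{[y,x]\mid y\in L\}$ for every $x\in L$. $\operatorname{AID}(L)$ denotes the set of all almost inner derivations of $L$. *)

theory Defs
  imports Complex_Main "HOL-Library.Function_Algebras"
begin

text \<open>A Lie algebra is a linear subspace \<open>L\<close> of an ambient vector space together with a bracket
  on \<open>L\<close>; the values of the bracket outside \<open>L\<close> are irrelevant.  Working with a carrier allows
  the same notion to be used for an abstract Lie algebra and for its algebra of derivations.\<close>

locale lie_algebra = vector_space scale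
  for scale :: "'k::field \<Rightarrow> 'a::ab_group_add \<Rightarrow> 'a" +
  fixes L :: "'a set"
    and br :: "'a \<Rightarrow> 'a \<Rightarrow> 'a"
  assumes subspace_L: "subspace L"
    and br_closed: "x \<in> L \<Longrightarrow> y \<in> L \<Longrightarrow> br x y \<in> L"
    and br_add_left: "x \<in> L \<Longrightarrow> y \<in> L \<Longrightarrow> z \<in> L \<Longrightarrow> br (x + y) z = br x z + br y z"
    and br_add_right: "x \<in> L \<Longrightarrow> y \<in> L \<Longrightarrow> z \<in> L \<Longrightarrow> br x (y + z) = br x y + br x z"
    and br_scale_left: "x \<in> L \<Longrightarrow> y \<in> L \<Longrightarrow> br (scale c x) y = scale c (br x y)"
    and br_scale_right: "x \<in> L \<Longrightarrow> y \<in> L \<Longrightarrow> br x (scale c y) = scale c (br x y)"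
    and br_self: "x \<in> L \<Longrightarrow> br x x = 0"
    and jacobi: "x \<in> L \<Longrightarrow> y \<in> L \<Longrightarrow> z \<in> L \<Longrightarrow>
      br x (br y z) + br y (br z x) + br z (br x y) = 0"

locale finite_dimensional_lie_algebra = lie_algebra scale L br
  for scale :: "'k::field \<Rightarrow> 'a::ab_group_add \<Rightarrow> 'a" and L :: "'a set" and br :: "'a \<Rightarrow> 'a \<Rightarrow> 'a" +
  assumes finite_dimensional: "\<exists>B. finite B \<and> span B = L"

text \<open>By skew-symmetry of the bracket there is no distinction between left and right ideals.\<close>

locale lie_ideal = lie_algebra scale L br
  for scale :: "'k::field \<Rightarrow> 'a::ab_group_add \<Rightarrow> 'a" and L :: "'a set" and br :: "'a \<Rightarrow> 'a \<Rightarrow> 'a" +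
  fixes I :: "'a set"
  assumes ideal_subset: "I \<subseteq> L"
    and subspace_ideal: "subspace I"
    and ideal_closed: "x \<in> L \<Longrightarrow> y \<in> I \<Longrightarrow> br x y \<in> I"

text \<open>A linear map \<open>L \<rightarrow> L\<close> is represented by its extension by \<open>0\<close> outside \<open>L\<close>, so that equality
  of derivations is equality of functions.  Sums and differences of functions are pointwise.\<close>

definition Der :: "('k::field \<Rightarrow> 'a::ab_group_add \<Rightarrow> 'a) \<Rightarrow> 'a set \<Rightarrow> ('a \<Rightarrow> 'a \<Rightarrow> 'a) \<Rightarrow> ('a \<Rightarrow> 'a) set"
  where "Der scale L br = {D.
      (\<forall>x\<in>L. D x \<in> L) \<and> (\<forall>x. x \<notin> L \<longrightarrow> D x = 0) \<and>
      (\<forall>x\<in>L. \<forall>y\<in>L. D (x + y) = D x + D y) \<and>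
      (\<forall>c. \<forall>x\<in>L. D (scale c x) = scale c (D x)) \<and>
      (\<forall>x\<in>L. \<forall>y\<in>L. D (br x y) = br (D x) y + br x (D y))}"

definition AID :: "('k::field \<Rightarrow> 'a::ab_group_add \<Rightarrow> 'a) \<Rightarrow> 'a set \<Rightarrow> ('a \<Rightarrow> 'a \<Rightarrow> 'a) \<Rightarrow> ('a \<Rightarrow> 'a) set"
  where "AID scale L br = {D \<in> Der scale L br. \<forall>x\<in>L. D x \<in> {br y x | y. y \<in> L}}"

definition fun_scale :: "('k \<Rightarrow> 'a \<Rightarrow> 'a) \<Rightarrow> 'k \<Rightarrow> ('a \<Rightarrow> 'a) \<Rightarrow> ('a \<Rightarrow> 'a)"
  where "fun_scale scale c f = (\<lambda>x. scale c (f x))"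

definition commutator :: "('a::ab_group_add \<Rightarrow> 'a) \<Rightarrow> ('a \<Rightarrow> 'a) \<Rightarrow> ('a \<Rightarrow> 'a)"
  where "commutator f g = (\<lambda>x. f (g x) - g (f x))"

end

theory Submission imports Defs begin

text \<open>Automorphisms of \<open>L\<close> preserve almost inner derivations under conjugation. For a derivation
  \<open>D\<close> and an almost inner \<open>\<phi>\<close>, the vectors \<open>exp (t D) (\<phi> (exp (- t D) x))\<close> therefore lie in the
  subspace \<open>[L, x]\<close> for all \<open>t\<close>. Any linear functional vanishing on \<open>[L, x]\<close> turns this curve into
  an everywhere convergent power series in \<open>t\<close> which is identically zero; its first-order
  coefficient is the value of the functional at \<open>[D, \<phi>] x\<close>. Since \<open>L\<close> carries no topology,
  convergence is expressed through linear functionals.\<close>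

section \<open>Functionals and endomorphisms of a finite-dimensional complex space\<close>

locale finite_basis = vector_space scale
  for scale :: "complex \<Rightarrow> 'a::ab_group_add \<Rightarrow> 'a" +
  fixes B :: "'a set"
  assumes finite_B: "finite B" and independent_B: "independent B"
begin

text \<open>Linearity is demanded on \<open>span B\<close> only: derivations and brackets are
  controlled only on \<open>L\<close>, and \<open>representation B\<close> is additive only on the
  span.\<close>

definition functional :: "('a \<Rightarrow> complex) \<Rightarrow> bool" where
  "functional h \<longleftrightarrow> (\<forall>x\<in>span B. \<forall>y\<in>span B. h (x + y) = h x + h y) \<and>
     (\<forall>c. \<forall>x\<in>span B. h (scale c x) = c * h x)"

definition endo :: "('a \<Rightarrow> 'a) \<Rightarrow> bool" where
  "endo T \<longleftrightarrow> (\<forall>x\<in>span B. T x \<in> span B) \<and>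
     (\<forall>x\<in>span B. \<forall>y\<in>span B. T (x + y) = T x + T y) \<and>
     (\<forall>c. \<forall>x\<in>span B. T (scale c x) = scale c (T x))"

lemma endo_closed: "endo T \<Longrightarrow> x \<in> span B \<Longrightarrow> T x \<in> span B"
  by (simp add: endo_def)

lemma endo_id: "endo (\<lambda>x. x)"
  by (simp add: endo_def)

lemma endo_funpow: "endo T \<Longrightarrow> endo (T ^^ n)"
  by (induction n) (simp_all add: endo_def)

lemma funpow_closed: "endo T \<Longrightarrow> v \<in> span B \<Longrightarrow> (T ^^ n) v \<in> span B"
  by (rule endo_closed[OF endo_funpow])

lemma functional_endo: "functional h \<Longrightarrow> endo T \<Longrightarrow> functional (\<lambda>x. h (T x))"
  by (simp add: functional_def endo_def)

lemma functional_cmult: "functional h \<Longrightarrow> functional (\<lambda>x. c * h x)"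
  by (simp add: functional_def algebra_simps)

lemma functional_coord: "functional (\<lambda>v. representation B v b)"
  using independent_B by (simp add: functional_def representation_add representation_scale)

lemma functional_zero: "functional h \<Longrightarrow> h 0 = 0"
proof -
  assume "functional h"
  then have "h (0 + 0) = h 0 + h 0"
    unfolding functional_def using span_zero by blast
  then show ?thesis by simp
qed

lemma functional_sum:
  assumes "functional h" "\<And>i. i \<in> I \<Longrightarrow> u i \<in> span B"
  shows "h (\<Sum>i\<in>I. u i) = (\<Sum>i\<in>I. h (u i))"
  using assms(2)
proof (induction I rule: infinite_finite_induct)
  case (insert i I)
  have "(\<Sum>i\<in>I. u i) \<in> span B"
    using insert.prems by (intro span_sum) auto
  with insert assms(1) show ?case
    by (simp add: functional_def)
qed (simp_all add: functional_zero assms(1))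

lemma functional_comb:
  assumes "functional h"
  shows "h (\<Sum>b\<in>B. scale (c b) b) = (\<Sum>b\<in>B. c b * h b)"
proof -
  have "h (\<Sum>b\<in>B. scale (c b) b) = (\<Sum>b\<in>B. h (scale (c b) b))"
    by (intro functional_sum assms span_scale span_base)
  also have "\<dots> = (\<Sum>b\<in>B. c b * h b)"
    using assms by (intro sum.cong) (auto simp: functional_def span_base)
  finally show ?thesis .
qed

lemma coord_sum:
  assumes "v \<in> span B"
  shows "(\<Sum>b\<in>B. scale (representation B v b) b) = v"
  using sum_representation_eq[OF independent_B assms finite_B order_refl] .

lemma functional_expand:
  assumes "functional h" "v \<in> span B"
  shows "h v = (\<Sum>b\<in>B. representation B v b * h b)"
  using functional_comb[OF assms(1), of "representation B v"] unfolding coord_sum[OF assms(2)] .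

text \<open>The coordinates are themselves functionals and determine a vector of the span. Vector
  identities thereby reduce to identities between scalar series.\<close>

lemma functional_eqI:
  assumes "u \<in> span B" "v \<in> span B" "\<And>h. functional h \<Longrightarrow> h u = h v"
  shows "u = v"
proof -
  have "representation B u = representation B v"
    using assms(3)[OF functional_coord] by blast
  then show ?thesis
    using coord_sum[OF assms(1)] coord_sum[OF assms(2)] by metis
qed

section \<open>Growth of iterates and the exponential of an endomorphism\<close>

text \<open>In the l1-norm \<open>p\<close> of the coordinates every functional is bounded and
  \<open>T\<close> has a finite operator bound \<open>R\<close>, so each iteration costs at most one
  factor \<open>R\<close>.\<close>

lemma functional_funpow_bound:
  assumes h: "functional h" and T: "endo T" and v: "v \<in> span B"
  shows "\<exists>M R. \<forall>k. norm (h ((T ^^ k) v)) \<le> M * R ^ k"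
proof -
  define p where "p u = (\<Sum>b\<in>B. norm (representation B u b))" for u
  define K where "K g = (\<Sum>b\<in>B. norm (g b))" for g :: "'a \<Rightarrow> complex"
  have bound: "norm (g u) \<le> K g * p u" if g: "functional g" and u: "u \<in> span B" for g u
  proof -
    have "norm (g u) \<le> (\<Sum>b\<in>B. norm (g b) * norm (representation B u b))"
      unfolding functional_expand[OF g u]
      by (rule norm_sum[THEN order_trans]) (simp add: norm_mult mult.commute)
    also have "\<dots> \<le> (\<Sum>b\<in>B. norm (g b) * p u)"
      unfolding p_def using finite_B
      by (intro sum_mono mult_left_mono) (auto intro: member_le_sum)
    finally show ?thesis by (simp add: K_def sum_distrib_right)
  qed
  \<comment> \<open>This is the sum of the absolute values of all matrix entries of
    \<open>T\<close>, a crude bound for its operator norm with respect to \<open>p\<close>.\<close>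
  define R where "R = (\<Sum>b\<in>B. K (\<lambda>u. representation B (T u) b))"
  have step: "p (T u) \<le> R * p u" if u: "u \<in> span B" for u
    unfolding p_def[of "T u"] R_def sum_distrib_right
    by (rule sum_mono) (rule bound[OF functional_endo[OF functional_coord T] u])
  have R: "0 \<le> R"
    by (simp add: R_def K_def sum_nonneg)
  have in_span: "(T ^^ k) v \<in> span B" for k
    by (rule funpow_closed[OF T v])
  have pk: "p ((T ^^ k) v) \<le> R ^ k * p v" for k
  proof (induction k)
    case (Suc k)
    have "p ((T ^^ Suc k) v) \<le> R * p ((T ^^ k) v)"
      using step[OF in_span] by simp
    also have "\<dots> \<le> R * (R ^ k * p v)"
      by (intro mult_left_mono Suc R)
    finally show ?case by simp
  qed simp
  have "norm (h ((T ^^ k) v)) \<le> (K h * p v) * R ^ k" for k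
  proof -
    have "norm (h ((T ^^ k) v)) \<le> K h * p ((T ^^ k) v)"
      by (intro bound h in_span)
    also have "\<dots> \<le> K h * (R ^ k * p v)"
      by (intro mult_left_mono pk) (simp add: K_def sum_nonneg)
    finally show ?thesis by (simp add: mult_ac)
  qed
  then show ?thesis by blast
qed

text \<open>The geometric growth of the iterates makes the series dominated by \<open>M\<close>
  times the real exponential series at \<open>norm t * R\<close>.\<close>

lemma summable_norm_exp:
  assumes "functional h" "endo T" "v \<in> span B"
  shows "summable (\<lambda>k. norm (t ^ k / fact k * h ((T ^^ k) v)))"
proof -
  obtain M R where MR: "\<And>k. norm (h ((T ^^ k) v)) \<le> M * R ^ k"
    using functional_funpow_bound[OF assms] by blast
  have "summable (\<lambda>k. M * ((norm t * R) ^ k /\<^sub>R fact k))"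
    by (intro summable_mult summable_exp_generic)
  moreover have "norm (t ^ k / fact k * h ((T ^^ k) v)) \<le> M * ((norm t * R) ^ k /\<^sub>R fact k)" for k
  proof -
    have "norm (t ^ k / fact k * h ((T ^^ k) v)) = norm t ^ k / fact k * norm (h ((T ^^ k) v))"
      by (simp add: norm_mult norm_divide norm_power)
    also have "\<dots> \<le> norm t ^ k / fact k * (M * R ^ k)"
      by (intro mult_left_mono MR) simp
    finally show ?thesis by (simp add: power_mult_distrib field_simps)
  qed
  ultimately show ?thesis
    by - (rule summable_comparison_test'[where N = 0], assumption,
        simp only: real_norm_def abs_norm_cancel)
qed

text \<open>This is exp(tT) v. Each coordinate is a scalar power series, so no topology on the
  vectors is involved.\<close>

definition expo :: "('a \<Rightarrow> 'a) \<Rightarrow> complex \<Rightarrow> 'a \<Rightarrow> 'a" where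
  "expo T t v = (\<Sum>b\<in>B. scale (\<Sum>k. t ^ k / fact k * representation B ((T ^^ k) v) b) b)"

lemma expo_closed: "expo T t v \<in> span B"
  unfolding expo_def by (intro span_sum span_scale span_base)

text \<open>A functional is a finite combination of coordinates, so it may be applied to the
  exponential series term by term.\<close>

lemma expo_sums:
  assumes h: "functional h" and T: "endo T" and v: "v \<in> span B"
  shows "(\<lambda>k. t ^ k / fact k * h ((T ^^ k) v)) sums h (expo T t v)"
proof -
  have "(\<lambda>k. \<Sum>b\<in>B. t ^ k / fact k * representation B ((T ^^ k) v) b * h b) sums
      (\<Sum>b\<in>B. (\<Sum>k. t ^ k / fact k * representation B ((T ^^ k) v) b) * h b)"
    by (rule sums_sum)
      (rule sums_mult2[OF summable_sums[OF summable_norm_cancel[OF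
        summable_norm_exp[OF functional_coord T v]]]])
  moreover have "(\<Sum>b\<in>B. t ^ k / fact k * representation B ((T ^^ k) v) b * h b) =
      t ^ k / fact k * h ((T ^^ k) v)" for k
    using functional_expand[OF h funpow_closed[OF T v], of k]
    by (simp add: sum_distrib_left mult_ac)
  ultimately show ?thesis
    unfolding expo_def functional_comb[OF h] by simp
qed

text \<open>Multiplicativity of the exponential and the expansion of a conjugate are both instances
  of this Cauchy product.\<close>

lemma sums_expo_Cauchy:
  assumes g: "\<And>i. functional (g i)"
    and summ: "\<And>u. u \<in> span B \<Longrightarrow> summable (\<lambda>i. norm (g i u))"
    and G: "\<And>u. u \<in> span B \<Longrightarrow> (\<lambda>i. g i u) sums G u"
    and T: "endo T" and v: "v \<in> span B"
  shows "(\<lambda>n. \<Sum>i\<le>n. s ^ (n - i) / fact (n - i) * g i ((T ^^ (n - i)) v)) sums G (expo T s v)"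
proof -
  \<comment> \<open>\<open>G\<close> is a pointwise limit of linear functionals, hence linear by
    uniqueness of limits. This allows it to be expanded in coordinates below.\<close>
  have fG: "functional G"
    unfolding functional_def
  proof safe
    fix x y assume x: "x \<in> span B" and y: "y \<in> span B"
    have "(\<lambda>i. g i (x + y)) sums (G x + G y)"
      using sums_add[OF G[OF x] G[OF y]] g x y by (simp add: functional_def)
    with G[OF span_add[OF x y]] show "G (x + y) = G x + G y"
      by (rule sums_unique2)
  next
    fix c x assume x: "x \<in> span B"
    have "(\<lambda>i. g i (scale c x)) sums (c * G x)"
      using sums_mult[OF G[OF x], of c] g x by (simp add: functional_def)
    with G[OF span_scale[OF x]] show "G (scale c x) = c * G x"
      by (rule sums_unique2)
  qed
  define a where "a b j = s ^ j / fact j * representation B ((T ^^ j) v) b" for b j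
  have a: "a b sums representation B (expo T s v) b" for b
    unfolding a_def by (rule expo_sums[OF functional_coord T v])
  have na: "summable (\<lambda>j. norm (a b j))" for b
    unfolding a_def by (rule summable_norm_exp[OF functional_coord T v])
  \<comment> \<open>For each basis vector, multiply the series of \<open>G b\<close> by the series
    of the \<open>b\<close>-coordinate of the exponential. Both converge absolutely; summing over
    the finite basis then gives the claim.\<close>
  have "(\<lambda>n. \<Sum>i\<le>n. g i b * a b (n - i)) sums (G b * representation B (expo T s v) b)"
    if "b \<in> B" for b
    using Cauchy_product_sums[OF summ[OF span_base[OF that]] na[of b]]
      sums_unique[OF G[OF span_base[OF that]]] sums_unique[OF a[of b]] by simp
  then have "(\<lambda>n. \<Sum>b\<in>B. \<Sum>i\<le>n. g i b * a b (n - i)) sums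
      (\<Sum>b\<in>B. G b * representation B (expo T s v) b)"
    by (intro sums_sum) auto
  moreover have "(\<Sum>b\<in>B. G b * representation B (expo T s v) b) = G (expo T s v)"
    using functional_expand[OF fG expo_closed[of T s v]] by (simp add: mult.commute)
  moreover have "(\<Sum>b\<in>B. \<Sum>i\<le>n. g i b * a b (n - i)) =
      (\<Sum>i\<le>n. s ^ (n - i) / fact (n - i) * g i ((T ^^ (n - i)) v))" for n
  proof -
    have "s ^ (n - i) / fact (n - i) * g i ((T ^^ (n - i)) v) = (\<Sum>b\<in>B. g i b * a b (n - i))" for i
      using functional_expand[OF g funpow_closed[OF T v], of i "n - i"]
      by (simp add: a_def sum_distrib_left mult_ac)
    then show ?thesis
      by (simp add: sum.swap[of _ B])
  qed
  ultimately show ?thesis by simp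
qed

text \<open>The outer exponential supplies the functionals \<open>g i\<close>, the inner one the
  argument. \<open>S\<close> need not commute with \<open>T\<close>: the identity yields inverses,
  an almost inner derivation yields the conjugated curve.\<close>

lemma expo_conj_sums:
  assumes h: "functional h" and T: "endo T" and S: "endo S" and v: "v \<in> span B"
  shows "(\<lambda>n. \<Sum>i\<le>n. s ^ (n - i) / fact (n - i) *
      (t ^ i / fact i * h ((T ^^ i) (S ((T ^^ (n - i)) v))))) sums h (expo T t (S (expo T s v)))"
proof (rule sums_expo_Cauchy[where g = "\<lambda>i u. t ^ i / fact i * h ((T ^^ i) (S u))"
      and G = "\<lambda>u. h (expo T t (S u))", OF _ _ _ T v])
  show "functional (\<lambda>u. t ^ i / fact i * h ((T ^^ i) (S u)))" for i
    by (rule functional_cmult[OF functional_endo[OF functional_endo[OF h endo_funpow[OF T]] S]])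
  fix u assume "u \<in> span B"
  then have Su: "S u \<in> span B"
    by (rule endo_closed[OF S])
  show "summable (\<lambda>i. norm (t ^ i / fact i * h ((T ^^ i) (S u))))"
    by (rule summable_norm_exp[OF h T Su])
  show "(\<lambda>i. t ^ i / fact i * h ((T ^^ i) (S u))) sums h (expo T t (S u))"
    by (rule expo_sums[OF h T Su])
qed

text \<open>With the identity in the middle, the powers of \<open>T\<close> merge into
  \<open>T ^^ n\<close>, and the binomial theorem turns the coefficient into (t + (-t))^n / n!. Only
  the term \<open>n = 0\<close> survives.\<close>

lemma expo_inverse:
  assumes T: "endo T" and v: "v \<in> span B"
  shows "expo T t (expo T (- t) v) = v"
proof (rule functional_eqI[OF expo_closed v])
  fix h assume h: "functional h"
  have "(\<Sum>i\<le>n. (- t) ^ (n - i) / fact (n - i) *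
      (t ^ i / fact i * h ((T ^^ i) ((T ^^ (n - i)) v)))) = (if n = 0 then h v else 0)" for n
  proof -
    have "(\<Sum>i\<le>n. (- t) ^ (n - i) / fact (n - i) *
        (t ^ i / fact i * h ((T ^^ i) ((T ^^ (n - i)) v)))) =
        (\<Sum>i\<le>n. of_nat (n choose i) * t ^ i * (- t) ^ (n - i)) * (h ((T ^^ n) v) / fact n)"
      unfolding sum_distrib_right
    proof (rule sum.cong)
      fix i assume "i \<in> {..n}"
      then have "(T ^^ i) ((T ^^ (n - i)) v) = (T ^^ n) v" "i \<le> n"
        using funpow_add[of i "n - i" T] by auto
      then show "(- t) ^ (n - i) / fact (n - i) *
          (t ^ i / fact i * h ((T ^^ i) ((T ^^ (n - i)) v))) =
          of_nat (n choose i) * t ^ i * (- t) ^ (n - i) * (h ((T ^^ n) v) / fact n)"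
        by (simp add: binomial_fact mult_ac)
    qed simp
    then show ?thesis
      using binomial_ring[of t "- t" n, symmetric] by (simp add: power_0_left)
  qed
  with expo_conj_sums[OF h T endo_id v, of "- t" t]
  have "(\<lambda>n. if n = 0 then h v else 0) sums h (expo T t (expo T (- t) v))"
    by simp
  then show "h (expo T t (expo T (- t) v)) = h v"
    using sums_single[of 0 "\<lambda>_. h v"] by (metis (no_types, lifting) sums_unique2)
qed

section \<open>Separating a vector from a subspace\<close>

text \<open>A basis of \<open>S\<close> stays independent when \<open>v\<close> is added, so some
  linear map takes the value 1 at \<open>v\<close> and 0 on that basis.\<close>

lemma functional_separates:
  assumes "subspace S" "v \<notin> S"
  shows "\<exists>h. functional h \<and> (\<forall>u\<in>S. h u = 0) \<and> h v \<noteq> 0"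
proof -
  \<comment> \<open>The scalars are viewed as a vector space over themselves, so that extension of
    linear maps from independent sets produces functionals.\<close>
  interpret vp: vector_space_pair scale "(*) :: complex \<Rightarrow> complex \<Rightarrow> complex"
    by unfold_locales (simp_all add: algebra_simps)
  obtain C where C: "C \<subseteq> S" "independent C" "S \<subseteq> span C"
    using maximal_independent_subset by blast
  have spanC: "span C = S"
    using C assms(1) by (metis span_eq_iff span_mono subset_antisym)
  have "independent (insert v C)"
    using C(2) assms(2) spanC by (simp add: independent_insert span_base)
  then obtain h where h: "Vector_Spaces.linear scale (*) h"
    and hv: "\<forall>x\<in>insert v C. h x = (if x = v then 1 else 0)"
    using vp.linear_independent_extend[of "insert v C" "\<lambda>x. if x = v then 1 else 0"] by blast
  have "h u = 0" if "u \<in> S" for u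
  proof -
    have "v \<notin> C" using C(1) assms(2) by auto
    then have "\<And>x. x \<in> C \<Longrightarrow> h x = 0" using hv by auto
    then show ?thesis
      using vp.linear_eq_0_on_span[OF h] that spanC by blast
  qed
  moreover have "functional h"
    unfolding functional_def using vp.linear_add[OF h] vp.linear_scale[OF h] by simp
  ultimately show ?thesis
    using hv by auto
qed

end

text \<open>Pascal's rule, in the form of the induction step of the Leibniz formula.\<close>

lemma sum_choose_Suc:
  fixes a :: "nat \<Rightarrow> nat \<Rightarrow> 'a::comm_ring_1"
  shows "(\<Sum>i\<le>n. of_nat (n choose i) * (a (Suc i) (n - i) + a i (Suc n - i))) =
    (\<Sum>i\<le>Suc n. of_nat (Suc n choose i) * a i (Suc n - i))"
proof -
  \<comment> \<open>The added term \<open>i = Suc n\<close> vanishes because its binomial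
    coefficient is 0. Splitting off \<open>i = 0\<close> then aligns the indices with the other
    sum.\<close>
  have "(\<Sum>i\<le>n. of_nat (n choose i) * a i (Suc n - i)) =
      (\<Sum>i\<le>Suc n. of_nat (n choose i) * a i (Suc n - i))"
    by (simp add: binomial_eq_0)
  also have "\<dots> = a 0 (Suc n) + (\<Sum>i\<le>n. of_nat (n choose Suc i) * a (Suc i) (n - i))"
    by (subst sum.atMost_Suc_shift) simp
  finally have *: "(\<Sum>i\<le>n. of_nat (n choose i) * a i (Suc n - i)) = \<dots>" .
  show ?thesis
    by (subst sum.atMost_Suc_shift) (simp add: * algebra_simps sum.distrib)
qed

section \<open>The Lie algebra of derivations and its subspace of almost inner derivations\<close>

context lie_algebra
begin

lemma mem_Der_iff: "D \<in> Der scale L br \<longleftrightarrow>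
    (\<forall>x\<in>L. D x \<in> L) \<and> (\<forall>x. x \<notin> L \<longrightarrow> D x = 0) \<and>
    (\<forall>x\<in>L. \<forall>y\<in>L. D (x + y) = D x + D y) \<and>
    (\<forall>c. \<forall>x\<in>L. D (scale c x) = scale c (D x)) \<and>
    (\<forall>x\<in>L. \<forall>y\<in>L. D (br x y) = br (D x) y + br x (D y))"
  by (simp add: Der_def)

lemma zero_in_L: "0 \<in> L"
  and add_in_L: "x \<in> L \<Longrightarrow> y \<in> L \<Longrightarrow> x + y \<in> L"
  and diff_in_L: "x \<in> L \<Longrightarrow> y \<in> L \<Longrightarrow> x - y \<in> L"
  and scale_in_L: "x \<in> L \<Longrightarrow> scale c x \<in> L"
  using subspace_L by (simp_all add: subspace_0 subspace_add subspace_diff subspace_scale)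

lemma br_zero_left: "x \<in> L \<Longrightarrow> br 0 x = 0"
  using br_add_left[of 0 0 x] zero_in_L by simp

lemma br_zero_right: "x \<in> L \<Longrightarrow> br x 0 = 0"
  using br_add_right[of x 0 0] zero_in_L by simp

lemma br_diff_left: "x \<in> L \<Longrightarrow> y \<in> L \<Longrightarrow> z \<in> L \<Longrightarrow> br (x - y) z = br x z - br y z"
  using br_add_left[of "x - y" y z] diff_in_L by (simp add: algebra_simps)

lemma br_diff_right: "x \<in> L \<Longrightarrow> y \<in> L \<Longrightarrow> z \<in> L \<Longrightarrow> br z (x - y) = br z x - br z y"
  using br_add_right[of z "x - y" y] diff_in_L by (simp add: algebra_simps)

text \<open>Outside \<open>L\<close> the value is the default 0, which also lies in
  \<open>L\<close>; hence there is no side condition on \<open>x\<close>.\<close>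

lemma Der_in_L: "D \<in> Der scale L br \<Longrightarrow> D x \<in> L"
  using zero_in_L by (cases "x \<in> L") (auto simp: mem_Der_iff)

lemma Der_add: "D \<in> Der scale L br \<Longrightarrow> x \<in> L \<Longrightarrow> y \<in> L \<Longrightarrow> D (x + y) = D x + D y"
  and Der_scale: "D \<in> Der scale L br \<Longrightarrow> x \<in> L \<Longrightarrow> D (scale c x) = scale c (D x)"
  and Der_br: "D \<in> Der scale L br \<Longrightarrow> x \<in> L \<Longrightarrow> y \<in> L \<Longrightarrow> D (br x y) = br (D x) y + br x (D y)"
  and Der_outside: "D \<in> Der scale L br \<Longrightarrow> x \<notin> L \<Longrightarrow> D x = 0"
  by (simp_all add: mem_Der_iff)

lemma Der_zero: "D \<in> Der scale L br \<Longrightarrow> D 0 = 0"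
  using Der_add[of D 0 0] zero_in_L by simp

lemma Der_diff: "D \<in> Der scale L br \<Longrightarrow> x \<in> L \<Longrightarrow> y \<in> L \<Longrightarrow> D (x - y) = D x - D y"
  using Der_add[of D "x - y" y] by (simp add: diff_in_L)

lemma AID_D: "D \<in> AID scale L br \<Longrightarrow> x \<in> L \<Longrightarrow> \<exists>y\<in>L. D x = br y x"
  by (auto simp: AID_def)

lemma vector_space_fun_scale: "vector_space (fun_scale scale)"
  by unfold_locales (auto simp: fun_scale_def fun_eq_iff algebra_simps)

lemma subspace_Der: "module.subspace (fun_scale scale) (Der scale L br)"
proof -
  interpret F: vector_space "fun_scale scale" by (rule vector_space_fun_scale)
  show ?thesis
  proof (rule F.subspaceI)
    show "0 \<in> Der scale L br"
      by (simp add: mem_Der_iff zero_in_L br_zero_left br_zero_right)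
    show "D + E \<in> Der scale L br" if "D \<in> Der scale L br" "E \<in> Der scale L br" for D E
      using that by (simp add: mem_Der_iff add_in_L br_add_left br_add_right algebra_simps)
    show "fun_scale scale c D \<in> Der scale L br" if "D \<in> Der scale L br" for c D
      using that by (simp add: mem_Der_iff fun_scale_def scale_in_L br_scale_left br_scale_right
          scale_right_distrib mult.commute)
  qed
qed

lemma commutator_in_Der:
  assumes D: "D \<in> Der scale L br" and E: "E \<in> Der scale L br"
  shows "commutator D E \<in> Der scale L br"
  unfolding mem_Der_iff commutator_def
proof (intro conjI ballI allI impI)
  note simps = Der_in_L[OF D] Der_in_L[OF E] Der_add[OF D] Der_add[OF E] Der_scale[OF D]
    Der_scale[OF E] Der_br[OF D] Der_br[OF E] br_closed diff_in_L
  fix x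
  show "D (E x) - E (D x) = 0" if "x \<notin> L"
    using that by (simp add: Der_outside[OF D] Der_outside[OF E] Der_zero[OF D] Der_zero[OF E])
  assume x: "x \<in> L"
  then show "D (E x) - E (D x) \<in> L"
    by (simp add: simps)
  show "D (E (scale c x)) - E (D (scale c x)) = scale c (D (E x) - E (D x))" for c
    using x by (simp add: simps scale_right_diff_distrib)
  fix y assume y: "y \<in> L"
  show "D (E (x + y)) - E (D (x + y)) = D (E x) - E (D x) + (D (E y) - E (D y))"
    using x y by (simp add: simps)
  show "D (E (br x y)) - E (D (br x y)) =
      br (D (E x) - E (D x)) y + br x (D (E y) - E (D y))"
    using x y by (simp add: simps br_diff_left br_diff_right)
qed

text \<open>The axioms are checked pointwise: \<open>Der_diff\<close> distributes the outer
  derivation over an inner commutator, after which the terms of the Jacobi identity cancel.\<close>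

lemma lie_algebra_Der: "lie_algebra (fun_scale scale) (Der scale L br) commutator"
proof -
  interpret F: vector_space "fun_scale scale" by (rule vector_space_fun_scale)
  show ?thesis
  proof unfold_locales
    show "F.subspace (Der scale L br)" by (rule subspace_Der)
    show "commutator f g \<in> Der scale L br" if "f \<in> Der scale L br" "g \<in> Der scale L br" for f g
      using that by (rule commutator_in_Der)
  qed (auto simp: commutator_def fun_scale_def fun_eq_iff Der_in_L Der_add Der_diff Der_scale
      scale_right_diff_distrib)
qed

text \<open>For fixed \<open>x\<close> the bracket \<open>br y x\<close> is linear in
  \<open>y\<close>, so the witnesses add and scale along with the derivations.\<close>

lemma subspace_AID: "module.subspace (fun_scale scale) (AID scale L br)"
proof -
  interpret F: vector_space "fun_scale scale" by (rule vector_space_fun_scale)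
  show ?thesis
  proof (rule F.subspaceI)
    show "0 \<in> AID scale L br"
      using F.subspace_0[OF subspace_Der] zero_in_L br_zero_left by (force simp: AID_def)
  next
    fix D E assume D: "D \<in> AID scale L br" and E: "E \<in> AID scale L br"
    have "\<exists>y. (D + E) x = br y x \<and> y \<in> L" if x: "x \<in> L" for x
    proof -
      obtain y z where "y \<in> L" "z \<in> L" "D x = br y x" "E x = br z x"
        using AID_D[OF D x] AID_D[OF E x] by blast
      with x show ?thesis
        by (intro exI[of _ "y + z"]) (simp add: br_add_left add_in_L)
    qed
    then show "D + E \<in> AID scale L br"
      using D E F.subspace_add[OF subspace_Der] by (simp add: AID_def)
  next
    fix c D assume D: "D \<in> AID scale L br"
    have "\<exists>y. fun_scale scale c D x = br y x \<and> y \<in> L" if x: "x \<in> L" for x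
    proof -
      obtain y where "y \<in> L" "D x = br y x"
        using AID_D[OF D x] by blast
      with x show ?thesis
        by (intro exI[of _ "scale c y"]) (simp add: br_scale_left scale_in_L fun_scale_def)
    qed
    then show "fun_scale scale c D \<in> AID scale L br"
      using D F.subspace_scale[OF subspace_Der] by (simp add: AID_def)
  qed
qed

text \<open>The set [L, x] is the image of a linear map. Being a subspace, it can be separated from
  any vector outside it.\<close>

lemma subspace_br_image:
  assumes x: "x \<in> L"
  shows "subspace {br y x | y. y \<in> L}"
proof (rule subspaceI)
  show "0 \<in> {br y x | y. y \<in> L}"
    using br_zero_left[OF x] zero_in_L by force
next
  fix u v assume "u \<in> {br y x | y. y \<in> L}" "v \<in> {br y x | y. y \<in> L}"
  then show "u + v \<in> {br y x | y. y \<in> L}"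
    using x br_add_left add_in_L by (auto, metis)
next
  fix c u assume "u \<in> {br y x | y. y \<in> L}"
  then show "scale c u \<in> {br y x | y. y \<in> L}"
    using x br_scale_left scale_in_L by (auto, metis)
qed

end

section \<open>Exponentials of derivations as automorphisms of \<open>L\<close>\<close>

locale lie_algebra_basis = lie_algebra scale L br + finite_basis scale B
  for scale :: "complex \<Rightarrow> 'a::ab_group_add \<Rightarrow> 'a" and L :: "'a set" and br :: "'a \<Rightarrow> 'a \<Rightarrow> 'a"
    and B :: "'a set" +
  assumes span_B: "span B = L"
begin

lemma Der_endo: "D \<in> Der scale L br \<Longrightarrow> endo D"
  by (simp add: endo_def span_B mem_Der_iff)

lemma endo_br_left: "y \<in> L \<Longrightarrow> endo (\<lambda>x. br x y)"
  and endo_br_right: "y \<in> L \<Longrightarrow> endo (br y)"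
  by (simp_all add: endo_def span_B br_closed br_add_left br_add_right br_scale_left br_scale_right)

text \<open>Iterated product rule for a derivation. Composing with a functional keeps the binomial
  coefficients among the complex scalars.\<close>

lemma Leibniz:
  assumes D: "D \<in> Der scale L br" and h: "functional h" and x: "x \<in> L" and y: "y \<in> L"
  shows "h ((D ^^ n) (br x y)) =
    (\<Sum>i\<le>n. of_nat (n choose i) * h (br ((D ^^ i) x) ((D ^^ (n - i)) y)))"
  using h
proof (induction n arbitrary: h)
  case (Suc n)
  have DL: "(D ^^ i) u \<in> L" if "u \<in> L" for i u
    using funpow_closed[OF Der_endo[OF D], of u i] that span_B by simp
  \<comment> \<open>The outermost \<open>D\<close> is absorbed into the functional, which is why the
    induction leaves \<open>h\<close> arbitrary.\<close>
  have "h ((D ^^ Suc n) (br x y)) =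
      (\<Sum>i\<le>n. of_nat (n choose i) * h (D (br ((D ^^ i) x) ((D ^^ (n - i)) y))))"
    using Suc.IH[OF functional_endo[OF Suc.prems Der_endo[OF D]]] by simp
  also have "\<dots> = (\<Sum>i\<le>n. of_nat (n choose i) *
      (h (br ((D ^^ Suc i) x) ((D ^^ (n - i)) y)) + h (br ((D ^^ i) x) ((D ^^ (Suc n - i)) y))))"
  proof (intro sum.cong refl arg_cong2[where f = "(*)"])
    fix i assume "i \<in> {..n}"
    then show "h (D (br ((D ^^ i) x) ((D ^^ (n - i)) y))) =
        h (br ((D ^^ Suc i) x) ((D ^^ (n - i)) y)) + h (br ((D ^^ i) x) ((D ^^ (Suc n - i)) y))"
      using Suc.prems DL[OF x] DL[OF y] Der_in_L[OF D]
      by (simp add: Der_br[OF D] Suc_diff_le functional_def span_B br_closed)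
  qed
  also have "\<dots> = (\<Sum>i\<le>Suc n. of_nat (Suc n choose i) *
      h (br ((D ^^ i) x) ((D ^^ (Suc n - i)) y)))"
    by (rule sum_choose_Suc)
  finally show ?case .
qed simp

text \<open>The Cauchy product of the two exponential series in the bracket has, by the Leibniz
  formula, the \<open>n\<close>-th term of the exponential series of \<open>br x y\<close>.\<close>

lemma expo_br:
  assumes D: "D \<in> Der scale L br" and x: "x \<in> L" and y: "y \<in> L"
  shows "expo D t (br x y) = br (expo D t x) (expo D t y)"
proof (rule functional_eqI)
  show "expo D t (br x y) \<in> span B" by (rule expo_closed)
  have closed: "expo D t u \<in> L" for u
    using expo_closed span_B by simp
  then show "br (expo D t x) (expo D t y) \<in> span B"
    by (simp add: span_B br_closed)
  note T = Der_endo[OF D]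
  have xs: "x \<in> span B" and ys: "y \<in> span B" and xys: "br x y \<in> span B"
    using x y br_closed span_B by auto
  have DL: "(D ^^ i) x \<in> L" for i
    using funpow_closed[OF T xs] span_B by simp
  fix h assume h: "functional h"
  have "(\<lambda>n. \<Sum>i\<le>n. t ^ (n - i) / fact (n - i) *
      (t ^ i / fact i * h (br ((D ^^ i) x) ((D ^^ (n - i)) y)))) sums
      h (br (expo D t x) (expo D t y))"
  \<comment> \<open>The series in \<open>x\<close> provides the functionals, with the second slot of
    the bracket as variable; for fixed \<open>u\<close> it converges by \<open>expo_sums\<close>
    applied to the functional sending \<open>x\<close> to \<open>h (br x u)\<close>.\<close>
  proof (rule sums_expo_Cauchy[where g = "\<lambda>i u. t ^ i / fact i * h (br ((D ^^ i) x) u)"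
        and G = "\<lambda>u. h (br (expo D t x) u)", OF _ _ _ T ys])
    show "functional (\<lambda>u. t ^ i / fact i * h (br ((D ^^ i) x) u))" for i
      by (rule functional_cmult[OF functional_endo[OF h endo_br_right[OF DL]]])
    fix u assume "u \<in> span B"
    then have u: "functional (\<lambda>x. h (br x u))"
      by (intro functional_endo[OF h endo_br_left]) (simp add: span_B)
    show "summable (\<lambda>i. norm (t ^ i / fact i * h (br ((D ^^ i) x) u)))"
      by (rule summable_norm_exp[OF u T xs])
    show "(\<lambda>i. t ^ i / fact i * h (br ((D ^^ i) x) u)) sums h (br (expo D t x) u)"
      by (rule expo_sums[OF u T xs])
  qed
  moreover have "(\<Sum>i\<le>n. t ^ (n - i) / fact (n - i) *
      (t ^ i / fact i * h (br ((D ^^ i) x) ((D ^^ (n - i)) y)))) =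
      t ^ n / fact n * h ((D ^^ n) (br x y))" for n
    unfolding Leibniz[OF D h x y] sum_distrib_left
  proof (intro sum.cong refl)
    fix i assume "i \<in> {..n}"
    then have "i \<le> n" "t ^ n = t ^ i * t ^ (n - i)"
      by (simp_all flip: power_add)
    then show "t ^ (n - i) / fact (n - i) *
        (t ^ i / fact i * h (br ((D ^^ i) x) ((D ^^ (n - i)) y))) =
        t ^ n / fact n * (of_nat (n choose i) * h (br ((D ^^ i) x) ((D ^^ (n - i)) y)))"
      by (simp add: binomial_fact mult_ac)
  qed
  ultimately show "h (expo D t (br x y)) = h (br (expo D t x) (expo D t y))"
    using expo_sums[OF h T xys, of t] by (simp add: sums_unique2)
qed

section \<open>Commutators of derivations with almost inner derivations\<close>

lemma commutator_in_AID:
  assumes D: "D \<in> Der scale L br" and P: "P \<in> AID scale L br"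
  shows "commutator D P \<in> AID scale L br"
proof -
  have P': "P \<in> Der scale L br"
    using P by (simp add: AID_def)
  have "commutator D P x \<in> {br y x | y. y \<in> L}" if x: "x \<in> L" for x
  proof (rule ccontr)
    assume "commutator D P x \<notin> {br y x | y. y \<in> L}"
    then obtain h where h: "functional h" and h0: "\<And>y. y \<in> L \<Longrightarrow> h (br y x) = 0"
      and hv: "h (commutator D P x) \<noteq> 0"
      using functional_separates[OF subspace_br_image[OF x]] by blast
    note T = Der_endo[OF D]
    have xs: "x \<in> span B" using x span_B by simp
    have closed: "expo D t u \<in> L" for t u
      using expo_closed span_B by simp
    have zero: "h (expo D t (P (expo D (- t) x))) = 0" for t
    proof -
      \<comment> \<open>Almost innerness is used at the moved point \<open>expo D (- t) x\<close>.
        Applying the automorphism \<open>expo D t\<close> to the resulting bracket brings its second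
        slot back to \<open>x\<close>.\<close>
      obtain y where y: "y \<in> L" "P (expo D (- t) x) = br y (expo D (- t) x)"
        using AID_D[OF P closed] by blast
      then show ?thesis
        using h0[OF closed] by (simp add: expo_br[OF D y(1) closed] expo_inverse[OF T xs])
    qed
    \<comment> \<open>\<open>c n\<close> is the coefficient of \<open>t ^ n\<close> in
      \<open>h\<close> applied to the conjugated curve; the signs come from the inner exponential at
      \<open>- t\<close>.\<close>
    define c where "c n = (\<Sum>i\<le>n. (- 1) ^ (n - i) / fact (n - i) *
        (1 / fact i * h ((D ^^ i) (P ((D ^^ (n - i)) x)))))" for n
    have sums: "(\<lambda>n. c n * t ^ n) sums 0" for t
    proof -
      have "c n * t ^ n = (\<Sum>i\<le>n. (- t) ^ (n - i) / fact (n - i) *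
          (t ^ i / fact i * h ((D ^^ i) (P ((D ^^ (n - i)) x)))))" for n
        unfolding c_def sum_distrib_right
      proof (intro sum.cong refl)
        fix i assume "i \<in> {..n}"
        then have "t ^ n = t ^ i * t ^ (n - i)"
          by (simp flip: power_add)
        then show "(- 1) ^ (n - i) / fact (n - i) *
            (1 / fact i * h ((D ^^ i) (P ((D ^^ (n - i)) x)))) * t ^ n =
            (- t) ^ (n - i) / fact (n - i) *
            (t ^ i / fact i * h ((D ^^ i) (P ((D ^^ (n - i)) x))))"
          by (simp add: power_minus[of t])
      qed
      then show ?thesis
        using expo_conj_sums[OF h T Der_endo[OF P'] xs, of "- t" t] zero[of t] by simp
    qed
    \<comment> \<open>Convergence at \<open>K = 1\<close> already allows termwise differentiation at
      0, which lies strictly inside the disc.\<close>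
    have "DERIV (\<lambda>t. \<Sum>n. c n * t ^ n) 0 :> (\<Sum>n. diffs c n * 0 ^ n)"
      by (rule termdiffs_strong[where K = 1]) (use sums_summable[OF sums[of 1]] in auto)
    moreover have "(\<lambda>t. \<Sum>n. c n * t ^ n) = (\<lambda>t. 0)"
      using sums by (simp add: fun_eq_iff sums_iff)
    ultimately have "(\<Sum>n. diffs c n * 0 ^ n) = 0"
      using DERIV_unique DERIV_const by metis
    \<comment> \<open>Since 0^0 = 1, only the term \<open>n = 0\<close> of the differentiated series
      remains, and \<open>diffs c 0\<close> is \<open>c 1\<close>.\<close>
    then have "c 1 = 0"
      by (simp add: diffs_def)
    \<comment> \<open>The index \<open>i = 1\<close> contributes \<open>h (D (P x))\<close>, and
      \<open>i = 0\<close> contributes \<open>- h (P (D x))\<close>.\<close>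
    moreover have "c 1 = h (D (P x)) - h (P (D x))"
      by (simp add: c_def)
    moreover have "h (D (P x)) = h (commutator D P x) + h (P (D x))"
    proof -
      have "h (commutator D P x + P (D x)) = h (commutator D P x) + h (P (D x))"
        using h Der_in_L[OF P'] Der_in_L[OF commutator_in_Der[OF D P']]
        by (simp add: functional_def span_B)
      then show ?thesis by (simp add: commutator_def)
    qed
    ultimately show False using hv by simp
  qed
  then show ?thesis
    using commutator_in_Der[OF D P'] by (simp add: AID_def)
qed

end

section \<open>Choice of a basis and the ideal property\<close>

theorem theorem2p13:
  fixes scale :: "complex \<Rightarrow> 'a::ab_group_add \<Rightarrow> 'a"
    and L :: "'a set"
    and br :: "'a \<Rightarrow> 'a \<Rightarrow> 'a"
  assumes "finite_dimensional_lie_algebra scale L br"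
  shows "lie_ideal (fun_scale scale) (Der scale L br) commutator (AID scale L br)"
proof -
  interpret finite_dimensional_lie_algebra scale L br by fact
  obtain C where C: "finite C" "span C = L"
    using finite_dimensional by blast
  \<comment> \<open>Thinning out a finite spanning set gives a basis that is again finite.\<close>
  obtain B where B: "B \<subseteq> C" "independent B" "C \<subseteq> span B"
    using maximal_independent_subset by blast
  have finite_B: "finite B"
    using B(1) C(1) by (rule finite_subset)
  have span_B: "span B = L"
    using B C by (metis span_mono span_span subset_antisym)
  interpret lie_algebra_basis scale L br B
    by unfold_locales (rule finite_B B(2) span_B)+
  interpret Der: lie_algebra "fun_scale scale" "Der scale L br" commutator
    by (rule lie_algebra_Der)
  show ?thesis
  proof unfold_locales
    show "AID scale L br \<subseteq> Der scale L br"
      by (auto simp: AID_def)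
  qed (simp_all add: subspace_AID commutator_in_AID)
qed

end
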